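(* Let $\mathbb{F}$ be any field and let $R_1,R_2$ be regular subgroups of $\mathrm{AGL}_n(\mathbb{F})$ such that $\delta_{R_1}$ and $\delta_{R_2}$ are linear maps. Then the following conditions are equivalent: (a) $R_1$ and $R_2$ are conjugate in $\widehat{\mathrm{GL}}_n(\mathbb{F})$ (i.e. by an element of $\widehat{\mathrm{GL}}_n(\mathbb{F})$); (b) $R_1$ and $R_2$ are conjugate in $\mathrm{AGL}_n(\mathbb{F})$; (c) the algebras $\mathcal{L}_{R_1}$ and $\mathcal{L}_{R_2}$ are isomorphic.
   Context: $\mathrm{AGL}_n(\mathbb{F})$ is the subgroup of $\mathrm{GL}_{n+1}(\mathbb{F})$ consisting of the matrices with first column $(1,0,\dots,0)^{\mathrm T}$, acting on the right on the affine points $(1,v)$, $v\in\mathbb{F}^n$. $\widehat{\mathrm{GL}}_n(\mathbb{F})$ is the stabilizer of $(1,0,\dots,0)$ in $\mathrm{AGL}_n(\mathbb{F})$, i.e. the set of matrices $\begin{pmatrix}1&0\\0&P\end{pmatrix}$ with $P\in\mathrm{GL}_n(\mathbb{F})$. A subgroup $R\le\mathrm{AGL}_n(\mathbb{F})$ is regular if for every $v\in\mathbb{F}^n$ there is exactly one element of $R$ with first row $(1,v)$; this element is written $\begin{pmatrix}1&v\\0&I_n+\delta_R(v)\end{pmatrix}$, defining $\delta_R:\mathbb{F}^n\to\mathrm{Mat}_n(\mathbb{F})$; "linear" means $\mathbb{F}$-linear. For such $R$, $\mathcal{L}_R=\mathbb{F}I_{n+1}+\left\{\begin{pmatrix}0&v\\0&\delta_R(v)\end{pmatrix}:v\in\mathbb{F}^n\right\}$,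 which is a subalgebra of $\mathrm{Mat}_{n+1}(\mathbb{F})$ when $\delta_R$ is linear; isomorphism means isomorphism of $\mathbb{F}$-algebras. *)

theory Defs
  imports "Jordan_Normal_Form.VS_Connect" "HOL-Algebra.QuotRing"
begin

definition GL :: "nat \<Rightarrow> 'a::field mat monoid" where
  "GL n = units_of (ring_mat TYPE('a) n ())"

definition AGL :: "nat \<Rightarrow> 'a::field mat monoid" where
  "AGL n = (GL (Suc n))
     \<lparr>carrier := {A \<in> carrier (GL (Suc n)). col A 0 = unit_vec (Suc n) 0}\<rparr>"

text \<open>The stabilizer of the affine point \<open>(1,0,\<dots>,0)\<close> under the right action of the affine group
  on row vectors; see \<open>GL_hat_eq\<close> below for the block form.\<close>

definition GL_hat :: "nat \<Rightarrow> 'a::field mat set" where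
  "GL_hat n = {A \<in> carrier (AGL n).
     mat_of_row (unit_vec (Suc n) 0) * A = mat_of_row (unit_vec (Suc n) 0)}"

definition regular_subgroup :: "nat \<Rightarrow> 'a::field mat set \<Rightarrow> bool" where
  "regular_subgroup n R \<longleftrightarrow> subgroup R (AGL n) \<and>
     (\<forall>v \<in> carrier_vec n. \<exists>!A. A \<in> R \<and> row A 0 = vCons 1 v)"

text \<open>Only the values on \<open>carrier_vec n\<close>, for a regular subgroup \<open>R\<close>, are meaningful;
  see \<open>delta_characterization\<close> below.\<close>

definition delta :: "nat \<Rightarrow> 'a::field mat set \<Rightarrow> 'a vec \<Rightarrow> 'a mat" where
  "delta n R v = (THE D. D \<in> carrier_mat n n \<and>
     four_block_mat (1\<^sub>m 1) (mat_of_row v) (0\<^sub>m n 1) (1\<^sub>m n + D) \<in> R)"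

definition L_alg :: "nat \<Rightarrow> 'a::field mat set \<Rightarrow> ('a, 'a mat) module" where
  "L_alg n R = (module_mat TYPE('a) (Suc n) (Suc n))
     \<lparr>carrier := {a \<cdot>\<^sub>m 1\<^sub>m (Suc n) +
                    four_block_mat (0\<^sub>m 1 1) (mat_of_row v) (0\<^sub>m n 1) (delta n R v)
                  | a v. v \<in> carrier_vec n}\<rparr>"

definition alg_iso :: "('k, 'm) ring_scheme \<Rightarrow> ('k, 'a) module \<Rightarrow> ('k, 'b) module \<Rightarrow> ('a \<Rightarrow> 'b) set" where
  "alg_iso K A B = {f \<in> ring_iso A B.
     \<forall>c \<in> carrier K. \<forall>x \<in> carrier A. f (c \<odot>\<^bsub>A\<^esub> x) = c \<odot>\<^bsub>B\<^esub> f x}"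

definition conjugate_by :: "('g, 'm) monoid_scheme \<Rightarrow> 'g set \<Rightarrow> 'g set \<Rightarrow> 'g set \<Rightarrow> bool" where
  "conjugate_by G H R S \<longleftrightarrow> (\<exists>g \<in> H. S = (inv\<^bsub>G\<^esub> g <#\<^bsub>G\<^esub> R) #>\<^bsub>G\<^esub> g)"

lemma group_GL: "group (GL n :: 'a::field mat monoid)"
proof -
  interpret ring "ring_mat TYPE('a) n ()" by (rule ring_mat)
  show ?thesis unfolding GL_def by (rule units_group)
qed

lemma carrier_GL:
  "carrier (GL n :: 'a::field mat monoid) =
     {A \<in> carrier_mat n n. \<exists>B \<in> carrier_mat n n. B * A = 1\<^sub>m n \<and> A * B = 1\<^sub>m n}"
  by (auto simp: GL_def units_of_def Units_def ring_mat_simps)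

lemma GL_simps: "mult (GL n) = (*)" "one (GL n) = 1\<^sub>m n"
  by (simp_all add: GL_def units_of_def ring_mat_simps)

lemma mult_col0:
  assumes "A \<in> carrier_mat m m" "B \<in> carrier_mat m m" "col B 0 = unit_vec m 0" "0 < m"
  shows "col (A * B) 0 = col (A :: 'a::field mat) 0"
proof -
  have "col (A * B) 0 = A *\<^sub>v unit_vec m 0"
    using assms col_mult2[of A m m B m 0] by simp
  also have "\<dots> = col A 0"
    using assms by (intro eq_vecI) (auto simp: scalar_prod_right_unit)
  finally show ?thesis .
qed

lemma subgroup_AGL: "subgroup (carrier (AGL n :: 'a::field mat monoid)) (GL (Suc n))"
proof -
  let ?G = "GL (Suc n) :: 'a mat monoid"
  interpret group ?G by (rule group_GL)
  show ?thesis
  proof (rule subgroupI)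
    show "carrier (AGL n :: 'a mat monoid) \<subseteq> carrier ?G" by (auto simp: AGL_def)
    have "\<one>\<^bsub>?G\<^esub> \<in> carrier (AGL n)"
      using one_closed by (auto simp: AGL_def GL_simps)
    then show "carrier (AGL n :: 'a mat monoid) \<noteq> {}" by blast
  next
    fix A :: "'a mat" assume "A \<in> carrier (AGL n)"
    then have A: "A \<in> carrier ?G" "col A 0 = unit_vec (Suc n) 0" by (auto simp: AGL_def)
    have i: "inv\<^bsub>?G\<^esub> A \<in> carrier ?G" using A by simp
    have "inv\<^bsub>?G\<^esub> A * A = 1\<^sub>m (Suc n)" using l_inv[OF A(1)] by (simp add: GL_simps)
    moreover have "col (inv\<^bsub>?G\<^esub> A * A) 0 = col (inv\<^bsub>?G\<^esub> A) 0"
      using A i by (intro mult_col0[of _ "Suc n"]) (auto simp: carrier_GL)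
    ultimately have "col (inv\<^bsub>?G\<^esub> A) 0 = unit_vec (Suc n) 0" by simp
    with i show "inv\<^bsub>?G\<^esub> A \<in> carrier (AGL n)" by (auto simp: AGL_def)
  next
    fix A B :: "'a mat" assume "A \<in> carrier (AGL n)" "B \<in> carrier (AGL n)"
    then have AB: "A \<in> carrier ?G" "col A 0 = unit_vec (Suc n) 0"
      "B \<in> carrier ?G" "col B 0 = unit_vec (Suc n) 0" by (auto simp: AGL_def)
    have "col (A * B) 0 = col A 0"
      using AB by (intro mult_col0[of _ "Suc n"]) (auto simp: carrier_GL)
    with AB m_closed[OF AB(1,3)] show "A \<otimes>\<^bsub>?G\<^esub> B \<in> carrier (AGL n)"
      by (auto simp: AGL_def GL_simps)
  qed
qed

lemma group_AGL: "group (AGL n :: 'a::field mat monoid)"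
  using group.subgroup_imp_group[OF group_GL subgroup_AGL[where 'a='a and n=n]]
  by (simp add: AGL_def)

lemma AGL_block:
  assumes "A \<in> carrier (AGL n :: 'a::field mat monoid)" "row A 0 = vCons 1 v" "v \<in> carrier_vec n"
  shows "A = four_block_mat (1\<^sub>m 1) (mat_of_row v) (0\<^sub>m n 1)
               (mat n n (\<lambda>(i,j). A $$ (Suc i, Suc j)))"
proof (rule eq_matI)
  have A: "A \<in> carrier_mat (Suc n) (Suc n)" and c: "col A 0 = unit_vec (Suc n) 0"
    using assms(1) by (auto simp: AGL_def carrier_GL)
  fix i j
  assume "i < dim_row (four_block_mat (1\<^sub>m 1) (mat_of_row v) (0\<^sub>m n 1)
               (mat n n (\<lambda>(i,j). A $$ (Suc i, Suc j))))"
    and "j < dim_col (four_block_mat (1\<^sub>m 1) (mat_of_row v) (0\<^sub>m n 1)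
               (mat n n (\<lambda>(i,j). A $$ (Suc i, Suc j))))"
  then have ij: "i < Suc n" "j < Suc n" by auto
  have 1: "A $$ (i, 0) = unit_vec (Suc n) 0 $ i" using arg_cong[OF c, of "\<lambda>w. w $ i"] A ij by simp
  have 2: "A $$ (0, j) = vCons 1 v $ j" using arg_cong[OF assms(2), of "\<lambda>w. w $ j"] A ij by simp
  show "A $$ (i, j) = four_block_mat (1\<^sub>m 1) (mat_of_row v) (0\<^sub>m n 1)
               (mat n n (\<lambda>(i,j). A $$ (Suc i, Suc j))) $$ (i, j)"
    using ij 1 2 assms(3) by (cases i; cases j) auto
qed (use assms in \<open>auto simp: AGL_def carrier_GL\<close>)

lemma delta_characterization:
  assumes R: "regular_subgroup n (R :: 'a::field mat set)" and v: "v \<in> carrier_vec n"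
  shows "delta n R v \<in> carrier_mat n n"
    and "A \<in> R \<and> row A 0 = vCons 1 v \<longleftrightarrow>
         A = four_block_mat (1\<^sub>m 1) (mat_of_row v) (0\<^sub>m n 1) (1\<^sub>m n + delta n R v)"
proof -
  let ?B = "\<lambda>D. four_block_mat (1\<^sub>m 1) (mat_of_row v) (0\<^sub>m n 1) (1\<^sub>m n + D)"
  obtain A0 where A0: "A0 \<in> R" "row A0 0 = vCons 1 v"
    and uniq: "\<And>A. A \<in> R \<Longrightarrow> row A 0 = vCons 1 v \<Longrightarrow> A = A0"
    using R v unfolding regular_subgroup_def by blast
  have "A0 \<in> carrier (AGL n)"
    using R A0(1) subgroup.subset unfolding regular_subgroup_def by blast
  note blk = AGL_block[OF this A0(2) v]
  define D0 where "D0 = mat n n (\<lambda>(i,j). A0 $$ (Suc i, Suc j)) - 1\<^sub>m n"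
  have D0: "D0 \<in> carrier_mat n n" unfolding D0_def by (rule minus_carrier_mat) simp
  have "1\<^sub>m n + D0 = mat n n (\<lambda>(i,j). A0 $$ (Suc i, Suc j))"
    by (rule eq_matI) (auto simp: D0_def)
  then have BD0: "?B D0 = A0" using blk by simp
  have row_B: "row (?B D) 0 = vCons 1 v" if "D \<in> carrier_mat n n" for D :: "'a mat"
    using that v by (intro eq_vecI) (auto simp: vec_index_vCons)
  have uD: "D = D0" if D: "D \<in> carrier_mat n n" "?B D \<in> R" for D :: "'a mat"
  proof -
    have e: "?B D = ?B D0" using uniq[OF D(2) row_B[OF D(1)]] BD0 by simp
    show ?thesis
    proof (rule eq_matI)
      fix i j assume "i < dim_row D0" "j < dim_col D0"
      then have ij: "i < n" "j < n" using D0 by auto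
      have "?B D $$ (Suc i, Suc j) = ?B D0 $$ (Suc i, Suc j)" using e by simp
      then show "D $$ (i, j) = D0 $$ (i, j)" using ij D(1) D0 v by simp
    qed (use D D0 in auto)
  qed
  have d: "delta n R v = D0"
    unfolding delta_def
  proof (rule the_equality)
    show "D0 \<in> carrier_mat n n \<and> ?B D0 \<in> R" using D0 A0(1) by (simp only: BD0 simp_thms)
  next
    fix D assume "D \<in> carrier_mat n n \<and> ?B D \<in> R"
    then show "D = D0" by (blast intro: uD)
  qed
  show "delta n R v \<in> carrier_mat n n" using d D0 by simp
  show "A \<in> R \<and> row A 0 = vCons 1 v \<longleftrightarrow> A = ?B (delta n R v)"
    unfolding d BD0 using A0 uniq by blast
qed

lemma GL_hat_eq:
  "GL_hat n = {four_block_mat (1\<^sub>m 1) (0\<^sub>m 1 n) (0\<^sub>m n 1) P | P. P \<in> carrier (GL n :: 'a::field mat monoid)}"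
    (is "_ = ?S")
proof (rule Set.set_eqI)
  fix A :: "'a mat"
  let ?e = "unit_vec (Suc n) 0 :: 'a vec"
  let ?B = "\<lambda>P. four_block_mat (1\<^sub>m 1) (0\<^sub>m 1 n) (0\<^sub>m n 1) (P :: 'a mat)"
  have z: "mat_of_row (0\<^sub>v n) = (0\<^sub>m 1 n :: 'a mat)" by (rule eq_matI) auto
  have ve: "vCons 1 (0\<^sub>v n) = ?e" by (rule eq_vecI) (auto simp: vec_index_vCons)
  have rw: "mat_of_row ?e * A = mat_of_row (row A 0)" if "A \<in> carrier_mat (Suc n) (Suc n)"
    for A :: "'a mat"
  proof (rule eq_matI)
    fix i j assume "i < dim_row (mat_of_row (row A 0))" "j < dim_col (mat_of_row (row A 0))"
    then show "(mat_of_row ?e * A) $$ (i, j) = mat_of_row (row A 0) $$ (i, j)"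
      using that by (auto simp: scalar_prod_left_unit)
  qed (use that in auto)
  have inj: "mat_of_row u = mat_of_row w \<longleftrightarrow> u = w" for u w :: "'a vec"
    by (metis row_mat_of_row)
  have hat: "A \<in> GL_hat n \<longleftrightarrow> A \<in> carrier (AGL n) \<and> row A 0 = vCons 1 (0\<^sub>v n)" for A :: "'a mat"
    by (auto simp: GL_hat_def ve AGL_def carrier_GL rw inj)
  have one: "1\<^sub>m (Suc n) = ?B (1\<^sub>m n)" by (rule eq_matI) auto
  have mul: "?B P * ?B Q = ?B (P * Q)" if "P \<in> carrier_mat n n" "Q \<in> carrier_mat n n" for P Q
    using that mult_four_block_mat[of "1\<^sub>m 1" 1 1 "0\<^sub>m 1 n" n "0\<^sub>m n 1" n P
        "1\<^sub>m 1" 1 "0\<^sub>m 1 n" n "0\<^sub>m n 1" Q] by simp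
  have binj: "P = Q" if "?B P = ?B Q" "P \<in> carrier_mat n n" "Q \<in> carrier_mat n n" for P Q
  proof (rule eq_matI)
    fix i j assume "i < dim_row Q" "j < dim_col Q"
    then show "P $$ (i, j) = Q $$ (i, j)"
      using arg_cong[OF that(1), of "\<lambda>M. M $$ (Suc i, Suc j)"] that(2,3) by simp
  qed (use that in auto)
  have blk: "\<exists>P \<in> carrier_mat n n. A = ?B P" if "A \<in> GL_hat n" for A :: "'a mat"
    using AGL_block[of A n "0\<^sub>v n"] that unfolding hat z by (metis mat_carrier zero_carrier_vec)
  show "A \<in> GL_hat n \<longleftrightarrow> A \<in> ?S"
  proof
    assume h: "A \<in> GL_hat n"
    interpret G: group "AGL n :: 'a mat monoid" by (rule group_AGL)
    have ms: "mult (AGL n) = (*)" "one (AGL n) = (1\<^sub>m (Suc n) :: 'a mat)"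
      by (simp_all add: AGL_def GL_simps)
    let ?A' = "inv\<^bsub>AGL n\<^esub> A"
    have A: "A \<in> carrier (AGL n)" "mat_of_row ?e * A = mat_of_row ?e" using h by (auto simp: GL_hat_def)
    have cm: "X \<in> carrier_mat (Suc n) (Suc n)" if "X \<in> carrier (AGL n)" for X :: "'a mat"
      using that by (auto simp: AGL_def carrier_GL)
    have A': "?A' \<in> carrier (AGL n)" "?A' * A = 1\<^sub>m (Suc n)" "A * ?A' = 1\<^sub>m (Suc n)"
      using G.inv_closed[OF A(1)] G.l_inv[OF A(1)] G.r_inv[OF A(1)] by (auto simp: ms)
    have "mat_of_row ?e * ?A' = (mat_of_row ?e * A) * ?A'" using A(2) by simp
    also have "\<dots> = mat_of_row ?e * (A * ?A')"
      by (rule assoc_mult_mat[OF _ cm[OF A(1)] cm[OF A'(1)], of _ 1]) (simp add: mat_of_row_carrier)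
    also have "\<dots> = mat_of_row ?e" using A'(3) by (simp add: right_mult_one_mat')
    finally have "?A' \<in> GL_hat n" using A'(1) by (simp add: GL_hat_def)
    then obtain Q where Q: "Q \<in> carrier_mat n n" "?A' = ?B Q" using blk by blast
    obtain P where P: "P \<in> carrier_mat n n" "A = ?B P" using blk h by blast
    have "?B (Q * P) = ?B Q * ?B P" by (rule mul[symmetric, OF Q(1) P(1)])
    also have "\<dots> = ?B (1\<^sub>m n)"
      by (simp only: P(2)[symmetric] Q(2)[symmetric] A'(2) one[symmetric])
    finally have QP: "Q * P = 1\<^sub>m n" by (rule binj) (use P(1) Q(1) in auto)
    have "?B (P * Q) = ?B P * ?B Q" by (rule mul[symmetric, OF P(1) Q(1)])
    also have "\<dots> = ?B (1\<^sub>m n)"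
      by (simp only: P(2)[symmetric] Q(2)[symmetric] A'(3) one[symmetric])
    finally have "P * Q = 1\<^sub>m n" by (rule binj) (use P(1) Q(1) in auto)
    with QP P(1) Q(1) have "P \<in> carrier (GL n)" unfolding carrier_GL by blast
    with P(2) show "A \<in> ?S" by blast
  next
    assume "A \<in> ?S"
    then obtain P Q where P: "A = ?B P" "P \<in> carrier_mat n n" "Q \<in> carrier_mat n n"
      "Q * P = 1\<^sub>m n" "P * Q = 1\<^sub>m n" by (auto simp: carrier_GL)
    have "?B Q * A = 1\<^sub>m (Suc n)" "A * ?B Q = 1\<^sub>m (Suc n)"
      by (simp_all only: P(1) one mul[OF P(3,2)] mul[OF P(2,3)] P(4,5))
    moreover have "A \<in> carrier_mat (Suc n) (Suc n)" "?B Q \<in> carrier_mat (Suc n) (Suc n)"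
      using P by auto
    ultimately have "A \<in> carrier (GL (Suc n))" unfolding carrier_GL by blast
    moreover have "col A 0 = ?e" using P by (intro eq_vecI) auto
    moreover have "row A 0 = vCons 1 (0\<^sub>v n)"
      using P by (intro eq_vecI) (auto simp: vec_index_vCons)
    ultimately show "A \<in> GL_hat n" by (simp add: hat AGL_def)
  qed
qed

end

theory Submission
  imports Defs
begin

text \<open>Write L for the algebra \<open>L_alg n R\<close> of a regular subgroup R with linear
  \<open>delta\<close>. Column 0 of an element of L vanishes below its top entry, so the (0,0) entry
  is its scalar part, and R is exactly the set of elements of L whose (0,0) entry is 1
  (\<open>R_iff_L\<close>). Conversely L consists of the sums of a scalar matrix and an element of R
  (\<open>L_eq_R\<close>). As R is a group, L is closed under products, and an element of L is
  invertible in L exactly when its (0,0) entry is nonzero (\<open>L_inverse\<close>,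
  \<open>L_non_unit\<close>): L is a local algebra and R is 1 plus its maximal ideal.

  Conjugation by an affine matrix fixes scalar matrices, so if it carries R1 to R2 it also carries
  the first algebra to the second (\<open>conjugate_imp_alg_iso\<close>).

  For the converse, an isomorphism f preserves scalars and non-units, hence the (0,0) entry, and so
  maps R1 onto R2. Taking first rows is a linear bijection from L to the row space of dimension n+1
  (\<open>L_row_unique\<close>, \<open>L_row_ex\<close>) under which right multiplication in L
  becomes the action of L on rows. In these coordinates f is an invertible matrix h, and
  multiplicativity of f says that conjugation by h induces f. Since f fixes 1 and preserves the
  (0,0) entry, the first row and first column of h are those of the identity, so h lies in
  \<open>GL_hat n\<close> (\<open>alg_iso_imp_conjugate\<close>).\<close>

section \<open>Row action and the affine group\<close>

text \<open>The right action on row vectors is phrased through \<open>*\<^sub>v\<close> with the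
  transposed matrix, the form in which first rows are computed and kernel vectors are found
  below.\<close>

lemma row_mult_transpose:
  fixes A B :: "'a::comm_semiring_0 mat"
  assumes "A \<in> carrier_mat m k" "B \<in> carrier_mat k l" "i < m"
  shows "row (A * B) i = transpose_mat B *\<^sub>v row A i"
proof (rule eq_vecI)
  fix j assume "j < dim_vec (transpose_mat B *\<^sub>v row A i)"
  then have j: "j < l" using assms by simp
  show "row (A * B) i $ j = (transpose_mat B *\<^sub>v row A i) $ j"
    using assms j comm_scalar_prod[of "row A i" k "col B j"] by simp
qed (use assms in auto)

lemma carrier_AGL:
  "A \<in> carrier (AGL n :: 'a::field mat monoid) \<longleftrightarrow>
     A \<in> carrier (GL (Suc n)) \<and> col A 0 = unit_vec (Suc n) 0"
  by (simp add: AGL_def)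

lemma AGL_simps:
  "mult (AGL n :: 'a::field mat monoid) = (*)"
  "one (AGL n :: 'a::field mat monoid) = 1\<^sub>m (Suc n)"
  by (simp_all add: AGL_def GL_simps)

lemma AGL_carrier_mat:
  "A \<in> carrier (AGL n :: 'a::field mat monoid) \<Longrightarrow> A \<in> carrier_mat (Suc n) (Suc n)"
  by (auto simp: carrier_AGL carrier_GL)

lemma conjugate_by_AGL:
  fixes R S :: "'a::field mat set"
  shows "conjugate_by (AGL n) H R S \<longleftrightarrow>
    (\<exists>g \<in> H. S = (\<lambda>r. inv\<^bsub>AGL n\<^esub> g * r * g) ` R)"
  by (auto simp: conjugate_by_def l_coset_def r_coset_def AGL_simps)

section \<open>The algebra of a regular subgroup with linear delta\<close>

text \<open>Packages the hypotheses shared by the two subgroups, so that every fact about the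
  algebra is available for each of them by interpretation.\<close>

locale linear_regular =
  fixes n :: nat and R :: "'a::field mat set"
  assumes regular: "regular_subgroup n R"
    and linear: "linear_map class_ring (module_vec TYPE('a) n) (module_mat TYPE('a) n n) (delta n R)"
begin

abbreviation L where "L \<equiv> carrier (L_alg n R)"

text \<open>This is r - 1 for the element r of \<open>R\<close> with first row (1,v). Linearity of
  \<open>delta\<close> makes it linear in \<open>v\<close>.\<close>

definition strict_block where
  "strict_block v = four_block_mat (0\<^sub>m 1 1) (mat_of_row v) (0\<^sub>m n 1) (delta n R v)"

lemma delta_carrier: "v \<in> carrier_vec n \<Longrightarrow> delta n R v \<in> carrier_mat n n"
  using delta_characterization(1)[OF regular] .

lemma delta_add:
  "v \<in> carrier_vec n \<Longrightarrow> w \<in> carrier_vec n \<Longrightarrow> delta n R (v + w) = delta n R v + delta n R w"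
  using linear unfolding linear_map_def mod_hom_def mod_hom_axioms_def LinearCombinations.module_hom_def
  by (auto simp: module_vec_simps module_mat_simps)

lemma delta_smult:
  "v \<in> carrier_vec n \<Longrightarrow> delta n R (c \<cdot>\<^sub>v v) = c \<cdot>\<^sub>m delta n R v"
  using linear unfolding linear_map_def mod_hom_def mod_hom_axioms_def LinearCombinations.module_hom_def
  by (auto simp: module_vec_simps module_mat_simps class_ring_simps)

lemma strict_block_carrier: "v \<in> carrier_vec n \<Longrightarrow> strict_block v \<in> carrier_mat (Suc n) (Suc n)"
  by (frule delta_carrier) (auto simp: strict_block_def)

lemma strict_block_col: "v \<in> carrier_vec n \<Longrightarrow> i < Suc n \<Longrightarrow> strict_block v $$ (i, 0) = 0"
  by (frule delta_carrier) (auto simp: strict_block_def)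

lemma strict_block_row: "v \<in> carrier_vec n \<Longrightarrow> j < n \<Longrightarrow> strict_block v $$ (0, Suc j) = v $ j"
  by (frule delta_carrier) (auto simp: strict_block_def)

lemma strict_block_add:
  assumes v: "v \<in> carrier_vec n" and w: "w \<in> carrier_vec n"
  shows "strict_block (v + w) = strict_block v + strict_block w"
  using v w delta_carrier[OF v] delta_carrier[OF w]
  by (intro eq_matI) (auto simp: strict_block_def delta_add)

lemma strict_block_smult:
  assumes v: "v \<in> carrier_vec n"
  shows "strict_block (c \<cdot>\<^sub>v v) = c \<cdot>\<^sub>m strict_block v"
  using v delta_carrier[OF v]
  by (intro eq_matI) (auto simp: strict_block_def delta_smult)

lemma carrier_L: "L = {a \<cdot>\<^sub>m 1\<^sub>m (Suc n) + strict_block v | a v. v \<in> carrier_vec n}"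
  by (simp add: L_alg_def strict_block_def)

lemma L_simps:
  "mult (L_alg n R) = (*)" "add (L_alg n R) = (+)" "one (L_alg n R) = 1\<^sub>m (Suc n)"
  "smult (L_alg n R) = (\<cdot>\<^sub>m)"
  by (simp_all add: L_alg_def module_mat_simps)

lemma L_carrier_mat: "x \<in> L \<Longrightarrow> x \<in> carrier_mat (Suc n) (Suc n)"
  using strict_block_carrier by (auto simp: carrier_L)

lemma L_I: "v \<in> carrier_vec n \<Longrightarrow> a \<cdot>\<^sub>m 1\<^sub>m (Suc n) + strict_block v \<in> L"
  by (auto simp: carrier_L)

lemma scalar_strict_block_col:
  assumes "v \<in> carrier_vec n" "i < Suc n"
  shows "(a \<cdot>\<^sub>m 1\<^sub>m (Suc n) + strict_block v) $$ (i, 0) = (if i = 0 then a else 0)"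
  using assms strict_block_carrier[OF assms(1)] by (simp add: strict_block_col)

lemma L_col: "x \<in> L \<Longrightarrow> i < Suc n \<Longrightarrow> i \<noteq> 0 \<Longrightarrow> x $$ (i, 0) = 0"
  unfolding carrier_L using scalar_strict_block_col by auto

lemma L_add: assumes "x \<in> L" "y \<in> L" shows "x + y \<in> L"
proof -
  obtain a v b w where *: "x = a \<cdot>\<^sub>m 1\<^sub>m (Suc n) + strict_block v" "v \<in> carrier_vec n"
    "y = b \<cdot>\<^sub>m 1\<^sub>m (Suc n) + strict_block w" "w \<in> carrier_vec n"
    using assms unfolding carrier_L by blast
  have "x + y = (a + b) \<cdot>\<^sub>m 1\<^sub>m (Suc n) + strict_block (v + w)"
    using * strict_block_carrier[OF *(2)] strict_block_carrier[OF *(4)]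
    by (intro eq_matI) (auto simp: strict_block_add algebra_simps)
  then show ?thesis using * by (simp only: L_I add_carrier_vec smult_carrier_vec)
qed

lemma L_smult: assumes "x \<in> L" shows "c \<cdot>\<^sub>m x \<in> L"
proof -
  obtain a v where *: "x = a \<cdot>\<^sub>m 1\<^sub>m (Suc n) + strict_block v" "v \<in> carrier_vec n"
    using assms unfolding carrier_L by blast
  have "c \<cdot>\<^sub>m x = (c * a) \<cdot>\<^sub>m 1\<^sub>m (Suc n) + strict_block (c \<cdot>\<^sub>v v)"
    using * strict_block_carrier[OF *(2)]
    by (intro eq_matI) (auto simp: strict_block_smult algebra_simps)
  then show ?thesis using * by (simp only: L_I add_carrier_vec smult_carrier_vec)
qed

lemma R_AGL: "R \<subseteq> carrier (AGL n)"
  using regular subgroup.subset unfolding regular_subgroup_def by blast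

text \<open>An affine matrix has (0,0) entry 1, so its first row is (1,v) for some v, and
  \<open>delta_characterization\<close> then determines the whole matrix.\<close>

lemma R_iff_strict_block: "A \<in> R \<longleftrightarrow> (\<exists>v \<in> carrier_vec n. A = 1\<^sub>m (Suc n) + strict_block v)"
proof -
  have eq: "1\<^sub>m (Suc n) + strict_block v =
      four_block_mat (1\<^sub>m 1) (mat_of_row v) (0\<^sub>m n 1) (1\<^sub>m n + delta n R v)"
    if "v \<in> carrier_vec n" for v
    using that delta_carrier[OF that] by (intro eq_matI) (auto simp: strict_block_def)
  have "1\<^sub>m (Suc n) + strict_block v \<in> R" if "v \<in> carrier_vec n" for v
    using delta_characterization(2)[OF regular that, of "1\<^sub>m (Suc n) + strict_block v"] eq[OF that] by blast
  moreover have "\<exists>v \<in> carrier_vec n. A = 1\<^sub>m (Suc n) + strict_block v" if A: "A \<in> R" for A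
  proof -
    let ?v = "vec n (\<lambda>j. A $$ (0, Suc j))"
    have A': "A \<in> carrier_mat (Suc n) (Suc n)" "col A 0 = unit_vec (Suc n) 0"
      using A R_AGL by (auto simp: carrier_AGL carrier_GL)
    have "A $$ (0, 0) = 1" using A'(1) arg_cong[OF A'(2), of "\<lambda>w. w $ 0"] by simp
    then have "row A 0 = vCons 1 ?v"
      using A' by (intro eq_vecI) (auto simp: vec_index_vCons)
    then show ?thesis
      using delta_characterization(2)[OF regular, of ?v A] A eq[of ?v]
      by (metis vec_carrier)
  qed
  ultimately show ?thesis by blast
qed

text \<open>The strict block has zero column 0, so the (0,0) entry reads off the scalar part. The
  subgroup can therefore be recovered from the algebra together with this entry.\<close>

lemma R_iff_L: "x \<in> R \<longleftrightarrow> x \<in> L \<and> x $$ (0, 0) = 1"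
proof -
  have 1: "1\<^sub>m (Suc n) = 1 \<cdot>\<^sub>m (1\<^sub>m (Suc n) :: 'a mat)" by (rule eq_matI) auto
  show ?thesis
  proof
    assume "x \<in> R"
    then obtain v where v: "v \<in> carrier_vec n" "x = 1 \<cdot>\<^sub>m 1\<^sub>m (Suc n) + strict_block v"
      unfolding R_iff_strict_block by (metis 1)
    then show "x \<in> L \<and> x $$ (0, 0) = 1"
      using scalar_strict_block_col[OF v(1), of 0 1] L_I[OF v(1), of 1] by simp
  next
    assume x: "x \<in> L \<and> x $$ (0, 0) = 1"
    then obtain a v where v: "v \<in> carrier_vec n" "x = a \<cdot>\<^sub>m 1\<^sub>m (Suc n) + strict_block v"
      unfolding carrier_L by blast
    have "a = 1" using scalar_strict_block_col[OF v(1), of 0 a] v(2) x by simp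
    then show "x \<in> R" using v unfolding R_iff_strict_block by (metis 1)
  qed
qed

lemma one_R: "1\<^sub>m (Suc n) \<in> R"
  using regular subgroup.one_closed by (fastforce simp: regular_subgroup_def AGL_simps)

lemma one_L: "1\<^sub>m (Suc n) \<in> L"
  using one_R R_iff_L by blast

text \<open>Moving 1 from the scalar a into the strict block gives the splitting (a - 1) + (1 +
  block). This form transfers closure under products, and later conjugation, from \<open>R\<close>
  to the algebra.\<close>

lemma L_eq_R: "L = {c \<cdot>\<^sub>m 1\<^sub>m (Suc n) + r | c r. r \<in> R}"
proof (intro equalityI subsetI)
  fix x assume "x \<in> L"
  then obtain a v where v: "v \<in> carrier_vec n" "x = a \<cdot>\<^sub>m 1\<^sub>m (Suc n) + strict_block v"
    unfolding carrier_L by blast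
  have "x = (a - 1) \<cdot>\<^sub>m 1\<^sub>m (Suc n) + (1\<^sub>m (Suc n) + strict_block v)"
    using v(2) strict_block_carrier[OF v(1)] by (intro eq_matI) (auto simp: algebra_simps)
  then show "x \<in> {c \<cdot>\<^sub>m 1\<^sub>m (Suc n) + r | c r. r \<in> R}" using v(1) unfolding R_iff_strict_block by blast
next
  fix x assume "x \<in> {c \<cdot>\<^sub>m 1\<^sub>m (Suc n) + r | c r. r \<in> R}"
  then show "x \<in> L" using R_iff_L by (auto intro!: L_add L_smult one_L)
qed

lemma zero_L: "0\<^sub>m (Suc n) (Suc n) \<in> L"
proof -
  have "0 \<cdot>\<^sub>m 1\<^sub>m (Suc n) = (0\<^sub>m (Suc n) (Suc n) :: 'a mat)" by (rule eq_matI) auto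
  then show ?thesis using L_smult[OF one_L, of 0] by simp
qed

text \<open>Expanding (a + r)(b + s) leaves linear combinations of elements of the algebra and the
  product r s, which lies in \<open>R\<close> because \<open>R\<close> is a group.\<close>

lemma L_mult: assumes "x \<in> L" "y \<in> L" shows "x * y \<in> L"
proof -
  let ?I = "1\<^sub>m (Suc n) :: 'a mat"
  obtain a r b s where *: "x = a \<cdot>\<^sub>m ?I + r" "r \<in> R" "y = b \<cdot>\<^sub>m ?I + s" "s \<in> R"
    using assms unfolding L_eq_R by blast
  have L: "r \<in> L" "s \<in> L" using * R_iff_L by auto
  note c = L_carrier_mat[OF L(1)] L_carrier_mat[OF L(2)] L_carrier_mat[OF assms(2)]
  have "r * s \<in> R"
    using regular subgroup.m_closed *(2,4) by (fastforce simp: regular_subgroup_def AGL_simps)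
  then have rs: "r * s \<in> L" using R_iff_L by blast
  have "x * y = a \<cdot>\<^sub>m y + r * y"
    unfolding *(1) using c
    by (simp add: add_mult_distrib_mat[of _ "Suc n" "Suc n"] mult_smult_assoc_mat[of _ "Suc n" "Suc n"])
  also have "r * y = b \<cdot>\<^sub>m r + r * s"
    unfolding *(3)
    using c(1) mult_add_distrib_mat[OF c(1) smult_carrier_mat[OF one_carrier_mat] c(2)]
      mult_smult_distrib[OF c(1) one_carrier_mat]
    by simp
  finally show ?thesis using L rs assms by (auto intro!: L_add L_smult)
qed

section \<open>First-row coordinates and units of the algebra\<close>

text \<open>The first row of a + \<open>strict_block v\<close> is (a,v), which determines the
  element. Together with \<open>L_row_ex\<close> this identifies the algebra with the space of rows
  of length n+1.\<close>

lemma L_row_unique: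
  assumes "x \<in> L" "y \<in> L" "row x 0 = row y 0"
  shows "x = y"
proof -
  obtain a v b w where *: "x = a \<cdot>\<^sub>m 1\<^sub>m (Suc n) + strict_block v" "v \<in> carrier_vec n"
    "y = b \<cdot>\<^sub>m 1\<^sub>m (Suc n) + strict_block w" "w \<in> carrier_vec n"
    using assms unfolding carrier_L by blast
  note c = strict_block_carrier[OF *(2)] strict_block_carrier[OF *(4)]
  have e: "x $$ (0, j) = y $$ (0, j)" if "j < Suc n" for j
    using arg_cong[OF assms(3), of "\<lambda>u. u $ j"] that c * by simp
  have "a = b" using e[of 0] * c by (simp add: strict_block_col)
  moreover have "v = w"
    using e[of "Suc _"] * c by (intro eq_vecI) (auto simp: strict_block_row)
  ultimately show ?thesis using * by simp
qed

lemma L_row_ex: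
  assumes w: "w \<in> carrier_vec (Suc n)"
  shows "\<exists>x \<in> L. row x 0 = w"
proof -
  let ?v = "vec n (\<lambda>j. w $ Suc j)"
  have v: "?v \<in> carrier_vec n" by simp
  have "row (w $ 0 \<cdot>\<^sub>m 1\<^sub>m (Suc n) + strict_block ?v) 0 = w"
  proof (rule eq_vecI)
    fix j assume "j < dim_vec w"
    then show "row (w $ 0 \<cdot>\<^sub>m 1\<^sub>m (Suc n) + strict_block ?v) 0 $ j = w $ j"
      using w strict_block_carrier[OF v] strict_block_col[OF v, of 0] strict_block_row[OF v] by (cases j) auto
  qed (use w strict_block_carrier[OF v] in auto)
  then show ?thesis using v unfolding carrier_L by blast
qed

text \<open>Dividing by the (0,0) entry lands in the group \<open>R\<close>, whose inverses again
  lie in the algebra.\<close>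

lemma L_inverse:
  assumes x: "x \<in> L" "x $$ (0, 0) \<noteq> 0"
  shows "\<exists>y \<in> L. x * y = 1\<^sub>m (Suc n)"
proof -
  interpret G: group "AGL n :: 'a mat monoid" by (rule group_AGL)
  let ?c = "x $$ (0, 0)"
  let ?r = "inverse ?c \<cdot>\<^sub>m x"
  note c = L_carrier_mat[OF x(1)]
  have r: "?r \<in> R" unfolding R_iff_L using x c by (auto intro: L_smult)
  define s where "s = inv\<^bsub>AGL n\<^esub> ?r"
  have s: "s \<in> R" using regular r subgroup.m_inv_closed
    unfolding s_def regular_subgroup_def by fastforce
  have "?r * s = 1\<^sub>m (Suc n)"
    using r R_AGL G.r_inv[of ?r] by (auto simp: s_def AGL_simps)
  moreover have sL: "s \<in> L" using s R_iff_L by blast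
  ultimately have "x * (inverse ?c \<cdot>\<^sub>m s) = 1\<^sub>m (Suc n)"
    using c L_carrier_mat[OF sL]
    by (simp add: mult_smult_distrib[of _ "Suc n" "Suc n"] mult_smult_assoc_mat[of _ "Suc n" "Suc n"])
  then show ?thesis using sL L_smult by blast
qed

text \<open>Column 0 of y vanishes below the top, so the (0,0) entry of x y is the product of the
  (0,0) entries.\<close>

lemma L_non_unit:
  assumes "x \<in> L" "y \<in> L" "x * y = 1\<^sub>m (Suc n)"
  shows "x $$ (0, 0) \<noteq> 0"
proof
  assume x0: "x $$ (0, 0) = 0"
  note c = L_carrier_mat[OF assms(1)] L_carrier_mat[OF assms(2)]
  have "(x * y) $$ (0, 0) = (\<Sum>i<Suc n. x $$ (0, i) * y $$ (i, 0))"
    using c by (simp add: scalar_prod_def lessThan_atLeast0)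
  also have "\<dots> = 0"
    using x0 L_col[OF assms(2)] by (intro sum.neutral) (metis lessThan_iff mult_eq_0_iff)
  finally show False using assms(3) by simp
qed

end

section \<open>From conjugacy to an algebra isomorphism\<close>

text \<open>Conjugation is an algebra automorphism of the full matrix algebra that fixes scalar
  matrices. By \<open>L_eq_R\<close> it therefore carries the algebra of \<open>R1\<close> onto that
  of its conjugate \<open>R2\<close>.\<close>

lemma conjugate_imp_alg_iso:
  fixes R1 R2 :: "'a::field mat set"
  assumes "linear_regular n R1" "linear_regular n R2"
    and g: "g \<in> carrier (AGL n)" and R2: "R2 = (\<lambda>r. inv\<^bsub>AGL n\<^esub> g * r * g) ` R1"
  shows "(\<lambda>x. inv\<^bsub>AGL n\<^esub> g * x * g) \<in> alg_iso class_ring (L_alg n R1) (L_alg n R2)"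
proof -
  interpret A: linear_regular n R1 by fact
  interpret B: linear_regular n R2 by fact
  interpret G: group "AGL n :: 'a mat monoid" by (rule group_AGL)
  define h where "h = inv\<^bsub>AGL n\<^esub> g"
  let ?m = "Suc n" let ?I = "1\<^sub>m ?m :: 'a mat" let ?f = "\<lambda>x. h * x * g"
  have hg: "h * g = ?I" "g * h = ?I" and c: "g \<in> carrier_mat ?m ?m" "h \<in> carrier_mat ?m ?m"
    using g G.l_inv[OF g] G.r_inv[OF g] AGL_carrier_mat[OF g] AGL_carrier_mat[OF G.inv_closed[OF g]]
    by (auto simp: h_def AGL_simps)
  have add: "?f (x + y) = ?f x + ?f y" if "x \<in> carrier_mat ?m ?m" "y \<in> carrier_mat ?m ?m" for x y
    using c that by (simp add: mult_add_distrib_mat[of _ ?m ?m] add_mult_distrib_mat[of _ ?m ?m])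
  have sm: "?f (a \<cdot>\<^sub>m x) = a \<cdot>\<^sub>m ?f x" if "x \<in> carrier_mat ?m ?m" for a x
    using c that by (simp add: mult_smult_distrib[of _ ?m ?m] mult_smult_assoc_mat[of _ ?m ?m])
  have mult: "?f (x * y) = ?f x * ?f y" if xy: "x \<in> carrier_mat ?m ?m" "y \<in> carrier_mat ?m ?m" for x y
  proof -
    have "?f x * ?f y = h * x * ((g * h) * y * g)"
      using c xy by (simp add: assoc_mult_mat[of _ ?m ?m _ ?m _ ?m])
    also have "\<dots> = ?f (x * y)"
      using c xy by (simp add: hg assoc_mult_mat[of _ ?m ?m _ ?m _ ?m])
    finally show ?thesis by simp
  qed
  have one: "?f ?I = ?I" using c hg by simp
  have inv: "g * ?f x * h = x" if "x \<in> carrier_mat ?m ?m" for x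
  proof -
    have "g * ?f x * h = (g * h) * x * (g * h)"
      using c that by (simp add: assoc_mult_mat[of _ ?m ?m _ ?m _ ?m])
    then show ?thesis using hg that by simp
  qed
  have img: "?f ` A.L = B.L"
  proof -
    have *: "?f (a \<cdot>\<^sub>m ?I + r) = a \<cdot>\<^sub>m ?I + ?f r" if "r \<in> R1" for a r
    proof -
      have "r \<in> carrier_mat ?m ?m" using that A.R_AGL AGL_carrier_mat by blast
      then show ?thesis
        using add[of "a \<cdot>\<^sub>m ?I" r] sm[of ?I a] by (simp only: one one_carrier_mat smult_carrier_mat)
    qed
    show ?thesis
      unfolding A.L_eq_R B.L_eq_R
      unfolding R2 h_def[symmetric]
    proof (intro equalityI subsetI)
      fix y assume "y \<in> {c \<cdot>\<^sub>m ?I + r |c r. r \<in> ?f ` R1}"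
      then obtain a r where "r \<in> R1" "y = a \<cdot>\<^sub>m ?I + ?f r" by blast
      then have "y = ?f (a \<cdot>\<^sub>m ?I + r)" "r \<in> R1" using * by auto
      then show "y \<in> ?f ` {c \<cdot>\<^sub>m ?I + r |c r. r \<in> R1}" by blast
    next
      fix y assume "y \<in> ?f ` {c \<cdot>\<^sub>m ?I + r |c r. r \<in> R1}"
      then obtain a r where "r \<in> R1" "y = ?f (a \<cdot>\<^sub>m ?I + r)" by blast
      then show "y \<in> {c \<cdot>\<^sub>m ?I + r |c r. r \<in> ?f ` R1}" using * by blast
    qed
  qed
  have "inj_on ?f A.L"
    by (rule inj_on_inverseI[where g = "\<lambda>y. g * y * h"]) (simp only: inv A.L_carrier_mat)
  with img have bij: "bij_betw ?f A.L B.L" by (simp add: bij_betw_def)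
  show ?thesis
    unfolding h_def[symmetric] alg_iso_def ring_iso_def Ring.ring_hom_def
    using bij img by (auto simp: A.L_simps B.L_simps add mult sm one A.L_carrier_mat)
qed

section \<open>From an algebra isomorphism to a conjugating matrix\<close>

text \<open>Taking the first row identifies the right regular module of \<open>L_alg n R\<close> with the row space
  \<open>F\<^sup>n\<^sup>+\<^sup>1\<close>; the matrix \<open>h\<close> of the isomorphism \<open>f\<close> in these coordinates satisfies
  \<open>y h = h f(y)\<close>. It lies in \<open>GL_hat n\<close> because \<open>f\<close> fixes the identity and preserves non-units,
  hence the \<open>(0,0)\<close> entry.\<close>

lemma alg_iso_imp_conjugate:
  fixes R1 R2 :: "'a::field mat set"
  assumes "linear_regular n R1" "linear_regular n R2"
    and f: "f \<in> alg_iso class_ring (L_alg n R1) (L_alg n R2)"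
  shows "conjugate_by (AGL n) (GL_hat n) R1 R2"
proof -
  interpret A: linear_regular n R1 by fact
  interpret B: linear_regular n R2 by fact
  interpret G: group "AGL n :: 'a mat monoid" by (rule group_AGL)
  let ?m = "Suc n" let ?I = "1\<^sub>m ?m :: 'a mat"
  note cA = A.L_carrier_mat and cB = B.L_carrier_mat
  have bij: "bij_betw f A.L B.L" and fB: "x \<in> A.L \<Longrightarrow> f x \<in> B.L"
    and f_mult: "x \<in> A.L \<Longrightarrow> y \<in> A.L \<Longrightarrow> f (x * y) = f x * f y"
    and f_add: "x \<in> A.L \<Longrightarrow> y \<in> A.L \<Longrightarrow> f (x + y) = f x + f y"
    and f_one: "f ?I = ?I"
    and f_smult: "x \<in> A.L \<Longrightarrow> f (a \<cdot>\<^sub>m x) = a \<cdot>\<^sub>m f x" for x y a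
    using f by (auto simp: alg_iso_def ring_iso_def Ring.ring_hom_def A.L_simps B.L_simps class_ring_simps)
  have f_inj: "x = y" if "x \<in> A.L" "y \<in> A.L" "f x = f y" for x y
    using bij that by (auto simp: bij_betw_def inj_on_def)
  have f_surj: "\<exists>x \<in> A.L. f x = y" if "y \<in> B.L" for y
    using bij that by (metis bij_betw_imp_surj_on imageE)

  \<comment> \<open>A nonzero (0,0) entry would make f x a unit; pulling its inverse back along f
    would make x a unit.\<close>
  have f_non_unit: "f x $$ (0, 0) = 0" if x: "x \<in> A.L" "x $$ (0, 0) = 0" for x
  proof (rule ccontr)
    assume "f x $$ (0, 0) \<noteq> 0"
    then obtain z where z: "z \<in> B.L" "f x * z = ?I" using B.L_inverse fB x by blast
    then obtain y where y: "y \<in> A.L" "f y = z" using f_surj by blast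
    have "x * y = ?I"
      using f_inj[of "x * y" ?I] A.L_mult A.one_L x y z f_mult f_one by simp
    then show False using A.L_non_unit x y by blast
  qed
  \<comment> \<open>Subtracting the scalar part of x leaves a non-unit, and f fixes scalar
    matrices.\<close>
  have f_00: "f x $$ (0, 0) = x $$ (0, 0)" if x: "x \<in> A.L" for x
  proof -
    let ?c = "- (x $$ (0, 0))"
    have y: "?c \<cdot>\<^sub>m ?I \<in> A.L" by (intro A.L_smult A.one_L)
    have "f (x + ?c \<cdot>\<^sub>m ?I) = f x + ?c \<cdot>\<^sub>m ?I"
      using x y A.one_L by (simp add: f_add f_smult f_one)
    moreover have "f (x + ?c \<cdot>\<^sub>m ?I) $$ (0, 0) = 0"
      using x y cA[OF x] by (intro f_non_unit A.L_add) auto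
    ultimately show ?thesis using cB[OF fB[OF x]] by simp
  qed

  \<comment> \<open>Basis of the first algebra that corresponds to the standard basis of row space
    under taking first rows.\<close>
  define b where "b i = (SOME x. x \<in> A.L \<and> row x 0 = unit_vec ?m i)" for i
  have b: "b i \<in> A.L" "row (b i) 0 = unit_vec ?m i" for i
    using someI_ex[of "\<lambda>x. x \<in> A.L \<and> row x 0 = unit_vec ?m i"] A.L_row_ex[of "unit_vec ?m i"]
    unfolding b_def by auto
  \<comment> \<open>Row i is the first row of f (b i): this is the matrix of f in first-row
    coordinates, acting on rows from the right.\<close>
  define h where "h = mat ?m ?m (\<lambda>(i, j). f (b i) $$ (0, j))"
  have h: "h \<in> carrier_mat ?m ?m" by (simp add: h_def)
  have row_h: "row h i = row (f (b i)) 0" if "i < ?m" for i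
    using that cB[OF fB[OF b(1)[of i]]] by (intro eq_vecI) (auto simp: h_def)
  have row_M: "row (b i * M) 0 = row M i" if "M \<in> carrier_mat ?m ?m" "i < ?m" for M i
  proof -
    have "row (b i * M) 0 = transpose_mat M *\<^sub>v unit_vec ?m i"
      using row_mult_transpose[OF cA[OF b(1)] that(1), of 0 i] b(2) by simp
    also have "\<dots> = row M i"
      using that by (intro eq_vecI) (auto simp: scalar_prod_right_unit)
    finally show ?thesis .
  qed

  have zero_A: "x = 0\<^sub>m ?m ?m" if x: "x \<in> A.L" "row x 0 = 0\<^sub>v ?m" for x
    using A.L_row_unique[OF x(1) A.zero_L] x(2) by simp
  have f_zero: "f (0\<^sub>m ?m ?m) = 0\<^sub>m ?m ?m"
  proof -
    have "0 \<cdot>\<^sub>m ?I = 0\<^sub>m ?m ?m" by (rule eq_matI) auto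
    then show ?thesis using f_smult[OF A.one_L, of 0] f_one by simp
  qed
  \<comment> \<open>Both sides are linear in x and agree on the basis b. Instead of expanding x as a
    sum, the induction is on a bound k for the positions of the nonzero entries in the first row of
    x.\<close>
  have star: "row (x * h) 0 = row (f x) 0" if "x \<in> A.L" for x
  proof -
    have "row (x * h) 0 = row (f x) 0"
      if "k \<le> ?m" "x \<in> A.L" "\<And>i. k \<le> i \<Longrightarrow> i < ?m \<Longrightarrow> x $$ (0, i) = 0" for k x
      using that
    proof (induction k arbitrary: x)
      case 0
      have "row x 0 = 0\<^sub>v ?m" using 0 cA[OF 0(2)] by (intro eq_vecI) auto
      then have x: "x = 0\<^sub>m ?m ?m" using zero_A 0(2) by blast
      show ?case unfolding x f_zero left_mult_zero_mat[OF h] ..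
    next
      case (Suc k)
      let ?c = "x $$ (0, k)"
      \<comment> \<open>Removing the b k component clears entry k and leaves the later entries zero,
        so the induction hypothesis applies.\<close>
      let ?y = "x + (- ?c) \<cdot>\<^sub>m b k"
      note cx = cA[OF Suc.prems(2)] and cb = cA[OF b(1)[of k]]
      have bL: "(- ?c) \<cdot>\<^sub>m b k \<in> A.L" by (intro A.L_smult b)
      then have y: "?y \<in> A.L" using A.L_add Suc.prems(2) by blast
      have "b k $$ (0, i) = (if i = k then 1 else 0)" if "i < ?m" for i
        using arg_cong[OF b(2)[of k], of "\<lambda>w. w $ i"] that cb Suc.prems(1) by simp
      then have "?y $$ (0, i) = 0" if "k \<le> i" "i < ?m" for i
        using that Suc.prems(3)[of i] cx cb by (cases "i = k") auto
      then have IH: "row (?y * h) 0 = row (f ?y) 0" using Suc.IH y Suc.prems(1) by simp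
      have 1: "?y * h = x * h + (- ?c) \<cdot>\<^sub>m (b k * h)"
        using cx cb h by (simp add: add_mult_distrib_mat[of _ ?m ?m] mult_smult_assoc_mat[of _ ?m ?m])
      have 2: "f ?y = f x + (- ?c) \<cdot>\<^sub>m f (b k)"
        using f_add[OF Suc.prems(2) bL] f_smult[OF b(1)] by simp
      have 3: "row (b k * h) 0 = row (f (b k)) 0" using row_M[OF h] row_h Suc.prems(1) by simp
      note cf = cB[OF fB[OF Suc.prems(2)]] cB[OF fB[OF b(1)[of k]]]
      show ?case
      proof (rule eq_vecI)
        fix j assume "j < dim_vec (row (f x) 0)"
        then have j: "j < ?m" using cf by simp
        show "row (x * h) 0 $ j = row (f x) 0 $ j"
          using arg_cong[OF IH, of "\<lambda>w. w $ j"] arg_cong[OF 3, of "\<lambda>w. w $ j"] j cf cx cb h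
          unfolding 1 2 by (simp del: row_mult)
      qed (use cf cx h in auto)
    qed
    from this[of ?m x] that show ?thesis by simp
  qed
  \<comment> \<open>Multiplying by b i on the left turns row i into a first row. Then
    \<open>star\<close> applies to the product b i * y, and f splits it as f (b i) * f y.\<close>
  have intertwine: "y * h = h * f y" if y: "y \<in> A.L" for y
  proof (rule eq_rowI)
    note cy = cA[OF y] cB[OF fB[OF y]]
    fix i assume "i < dim_row (h * f y)"
    then have i: "i < ?m" using h by simp
    note cb = cA[OF b(1)[of i]] cB[OF fB[OF b(1)[of i]]]
    have "row (y * h) i = row (b i * y * h) 0"
      using row_M[of "y * h" i] i cy cb h by (simp del: row_mult add: assoc_mult_mat[of _ ?m ?m _ ?m _ ?m])
    also have "\<dots> = row (f (b i) * f y) 0"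
      using star[of "b i * y"] A.L_mult b(1) y f_mult by simp
    also have "\<dots> = transpose_mat (f y) *\<^sub>v row h i"
      using row_mult_transpose[OF cb(2) cy(2)] row_h[OF i] by simp
    also have "\<dots> = row (h * f y) i"
      using row_mult_transpose[OF h cy(2) i] by simp
    finally show "row (y * h) i = row (h * f y) i" .
  qed (use h cA[OF y] cB[OF fB[OF y]] in auto)

  \<comment> \<open>A kernel vector of the transpose is a row w with w h = 0. The element x with
    first row w then has f x with zero first row, so f x = 0 and x = 0 by injectivity.\<close>
  have "det (transpose_mat h) \<noteq> 0"
  proof
    assume "det (transpose_mat h) = 0"
    then obtain w where w: "w \<in> carrier_vec ?m" "w \<noteq> 0\<^sub>v ?m" "transpose_mat h *\<^sub>v w = 0\<^sub>v ?m"
      using det_0_iff_vec_prod_zero[of "transpose_mat h" ?m] h by auto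
    obtain x where x: "x \<in> A.L" "row x 0 = w" using A.L_row_ex[OF w(1)] by blast
    have "row (f x) 0 = row (f (0\<^sub>m ?m ?m)) 0"
      using star[OF x(1)] row_mult_transpose[OF cA[OF x(1)] h, of 0] x(2) w(3) f_zero by simp
    then have "x = 0\<^sub>m ?m ?m"
      using B.L_row_unique[OF fB[OF x(1)] fB[OF A.zero_L]] f_inj[OF x(1) A.zero_L] by blast
    then show False using w x by simp
  qed
  then have "det h \<noteq> 0" using det_transpose[OF h] by simp
  then have "h \<in> carrier (GL ?m)"
    using det_non_zero_imp_unit[OF h, of "()"] by (simp add: GL_def units_of_def)
  \<comment> \<open>Entry i is the (0,0) entry of f (b i), which equals that of b i because f
    preserves this entry.\<close>
  moreover have "col h 0 = unit_vec ?m 0"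
  proof (rule eq_vecI)
    fix i assume "i < dim_vec (unit_vec ?m 0 :: 'a vec)"
    then have i: "i < ?m" by simp
    have "b i $$ (0, 0) = unit_vec ?m i $ 0"
      using arg_cong[OF b(2)[of i], of "\<lambda>w. w $ 0"] cA[OF b(1)[of i]] by simp
    then show "col h 0 $ i = unit_vec ?m 0 $ i"
      using f_00[OF b(1)] i h by (auto simp: h_def)
  qed (use h in auto)
  ultimately have hA: "h \<in> carrier (AGL n)" by (simp add: carrier_AGL)
  have "row h 0 = unit_vec ?m 0"
  proof -
    have "b 0 = ?I" using A.L_row_unique[OF b(1) A.one_L] b(2) by simp
    then show ?thesis using row_h[of 0] f_one by simp
  qed
  have "mat_of_row (unit_vec ?m 0) * h = mat_of_row (unit_vec ?m 0)"
  proof (rule eq_rowI)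
    fix i assume "i < dim_row (mat_of_row (unit_vec ?m 0 :: 'a vec))"
    then have "i = 0" by simp
    have "row (mat_of_row (unit_vec ?m 0) * h) 0 = transpose_mat h *\<^sub>v unit_vec ?m 0"
      using row_mult_transpose[of "mat_of_row (unit_vec ?m 0)" 1 ?m h ?m 0] h by simp
    also have "\<dots> = row h 0"
      using h by (intro eq_vecI) (auto simp: scalar_prod_right_unit)
    finally show "row (mat_of_row (unit_vec ?m 0) * h) i = row (mat_of_row (unit_vec ?m 0)) i"
      using \<open>i = 0\<close> \<open>row h 0 = unit_vec ?m 0\<close> by simp
  qed (use h in auto)
  with hA have hat: "h \<in> GL_hat n" by (simp add: GL_hat_def)

  define k where "k = inv\<^bsub>AGL n\<^esub> h"
  have k: "k * h = ?I" "k \<in> carrier_mat ?m ?m"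
    using G.l_inv[OF hA] AGL_carrier_mat[OF G.inv_closed[OF hA]] by (auto simp: k_def AGL_simps)
  have conj: "k * y * h = f y" if y: "y \<in> A.L" for y
  proof -
    have "k * y * h = k * (h * f y)"
      using intertwine[OF y] cA[OF y] k h by simp
    also have "\<dots> = k * h * f y"
      by (rule assoc_mult_mat[symmetric, OF k(2) h cB[OF fB[OF y]]])
    finally show ?thesis using k cB[OF fB[OF y]] by simp
  qed
  \<comment> \<open>Membership in either subgroup means lying in its algebra with (0,0) entry 1, and
    f respects both conditions.\<close>
  have "R2 = f ` R1"
  proof (intro equalityI subsetI)
    fix y assume "y \<in> R2"
    then have y: "y \<in> B.L" "y $$ (0, 0) = 1" by (simp_all add: B.R_iff_L)
    obtain x where "x \<in> A.L" "f x = y" using f_surj[OF y(1)] by blast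
    then show "y \<in> f ` R1" using f_00[of x] y(2) by (auto simp: A.R_iff_L)
  next
    fix y assume "y \<in> f ` R1"
    then show "y \<in> R2" using fB f_00 by (auto simp: A.R_iff_L B.R_iff_L)
  qed
  also have "\<dots> = (\<lambda>y. k * y * h) ` R1"
    using conj A.R_iff_L by (intro image_cong) auto
  finally show ?thesis using hat unfolding conjugate_by_AGL k_def by blast
qed

theorem proposition3p4:
  fixes n :: nat and R1 R2 :: "'a::field mat set"
  assumes "regular_subgroup n R1" and "regular_subgroup n R2"
    and "linear_map class_ring (module_vec TYPE('a) n) (module_mat TYPE('a) n n) (delta n R1)"
    and "linear_map class_ring (module_vec TYPE('a) n) (module_mat TYPE('a) n n) (delta n R2)"
  shows "(conjugate_by (AGL n) (GL_hat n) R1 R2 \<longleftrightarrow> conjugate_by (AGL n) (carrier (AGL n)) R1 R2) \<and>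
         (conjugate_by (AGL n) (carrier (AGL n)) R1 R2 \<longleftrightarrow>
            alg_iso class_ring (L_alg n R1) (L_alg n R2) \<noteq> {})"
proof -
  have lr: "linear_regular n R1" "linear_regular n R2"
    using assms by (auto intro: linear_regular.intro)
  \<comment> \<open>The equivalences follow from a cycle of three implications, of which this first
    one only uses that \<open>GL_hat n\<close> lies in the affine group.\<close>
  have "conjugate_by (AGL n) (carrier (AGL n)) R1 R2" if "conjugate_by (AGL n) (GL_hat n) R1 R2"
    using that by (auto simp: conjugate_by_def GL_hat_def)
  moreover have "alg_iso class_ring (L_alg n R1) (L_alg n R2) \<noteq> {}"
    if "conjugate_by (AGL n) (carrier (AGL n)) R1 R2"
    using that conjugate_imp_alg_iso[OF lr] unfolding conjugate_by_AGL by blast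
  moreover have "conjugate_by (AGL n) (GL_hat n) R1 R2"
    if "alg_iso class_ring (L_alg n R1) (L_alg n R2) \<noteq> {}"
    using that alg_iso_imp_conjugate[OF lr] by blast
  ultimately show ?thesis by blast
qed

end
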